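(* Let $u\in[2]^n$ be a word of length $n$ over $\{1,2\}$ with $m_1(u)=m_2(u)\ge1$. Then for a word $w$ over the positive integers, $w\in C(u)$ if and only if both of the following hold: (a) $\min(c_1(w),c_2(w))\ge c_1(u)$, or $c_1(w)=c_2(w)<c_1(u)$; (b) $\max R_i(w)\le 2$ for $i\le 2$.
   Context: Juxtaposition denotes concatenation of words. $P(w)$ is the insertion tableau of $w$ under the Robinson–Schensted–Knuth (row-insertion) correspondence, and $C(u)=\{w : P(uw)=P(wu)\}$. $R_i(w)$ denotes the $i$th row of $P(w)$ (empty if $P(w)$ has fewer than $i$ rows; the condition $\max R_i(w)\le2$ holds vacuously for an empty row). $m_a(u)$ is the number of occurrences of the letter $a$ in $u$. For a positive integer $a$, $c_a(w)$ is the number of singleton $a$-columns of $P(w)$, i.e. columns of $P(w)$ of length exactly one whose sole entry is $a$. *)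

theory Defs
  imports Main
begin

text \<open>
  Words are lists of natural numbers whose letters are positive.  A tableau is the list of its
  rows, from the longest (first) row downwards, without empty rows.
\<close>

definition words :: "nat list set" where
  "words = lists {1..}"

text \<open>
  Row insertion of \<open>x\<close>: if no entry exceeds \<open>x\<close> then append \<open>x\<close>, otherwise \<open>x\<close> replaces the
  leftmost entry strictly greater than \<open>x\<close>, and that entry is bumped.
\<close>

fun row_insert :: "nat \<Rightarrow> nat list \<Rightarrow> nat list \<times> nat option" where
  "row_insert x [] = ([x], None)"
| "row_insert x (y # ys) =
     (if x < y then (x # ys, Some y)
      else let (ys', b) = row_insert x ys in (y # ys', b))"

fun tableau_insert :: "nat list list \<Rightarrow> nat \<Rightarrow> nat list list" where
  "tableau_insert [] x = [[x]]"
| "tableau_insert (r # rs) x =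
     (case row_insert x r of
        (r', None) \<Rightarrow> r' # rs
      | (r', Some y) \<Rightarrow> r' # tableau_insert rs y)"

definition insertion_tableau :: "nat list \<Rightarrow> nat list list" where
  "insertion_tableau w = foldl tableau_insert [] w"

definition plactic_centralizer :: "nat list \<Rightarrow> nat list set" where
  "plactic_centralizer u = {w \<in> words. insertion_tableau (u @ w) = insertion_tableau (w @ u)}"

text \<open>Rows are numbered from 1; \<open>tableau_row i w\<close> is meant for \<open>i \<ge> 1\<close>.\<close>

definition tableau_row :: "nat \<Rightarrow> nat list \<Rightarrow> nat list" where
  "tableau_row i w = (if i \<le> length (insertion_tableau w) then insertion_tableau w ! (i - 1) else [])"

text \<open>As row lengths weakly decrease, \<^term>\<open>transpose (insertion_tableau w)\<close> is the list of columns of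
  \<^term>\<open>insertion_tableau w\<close>, each read from top (first row) to bottom.\<close>

definition singleton_columns :: "nat \<Rightarrow> nat list \<Rightarrow> nat" where
  "singleton_columns a w = count_list (transpose (insertion_tableau w)) [a]"

end

theory Submission
  imports Defs
begin

text \<open>
  Everything happens in the first two rows.  Multiplying \<open>w\<close> on the left by a letter \<open>x \<le> 2\<close>
  is a slide inside the first two rows of \<open>P(w)\<close>, so it leaves the deeper rows unchanged and never
  removes an entry from the first row.  Multiplying on the right by \<open>2\<close>, in contrast, removes an
  entry \<open>> 2\<close> from the first row as long as there is one.  If \<open>P(uw) = P(wu)\<close>, then the first row of
  \<open>P(w)\<close> thus has entries \<open>\<le> 2\<close> only, and inserting \<open>u\<close> into \<open>P(w)\<close> bumps nothing out of the
  second row; an entry \<open>> 2\<close> in the second row would then force the first row to grow by all of \<open>u\<close>,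
  which the slides do not allow.

  Once the first two rows consist of letters \<open>\<le> 2\<close>, let \<open>p\<close> and \<open>q\<close> be the numbers of singleton
  columns \<open>1\<close> and \<open>2\<close>, and let \<open>u\<close> have \<open>c\<close> of each.  Up to central factors \<open>21\<close> the word \<open>u\<close>
  is \<open>1\<^sup>c 2\<^sup>c\<close>, and counting the singleton columns \<open>1\<close> on both sides turns commutation into
  \<open>(p - c) + c = p + (c - q)\<close> with truncated subtraction, which is the stated condition.
\<close>

section \<open>Row insertion into a single row\<close>

lemma row_insert_cases:
  obtains (append) "\<forall>a\<in>set r. a \<le> y" "row_insert y r = (r @ [y], None)"
  | (bump) A z B where "r = A @ z # B" "\<forall>a\<in>set A. a \<le> y" "y < z" "row_insert y r = (A @ y # B, Some z)"
proof (induction r arbitrary: thesis)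
  case Nil
  then show ?case by simp
next
  case (Cons b r)
  show ?case
  proof (cases "y < b")
    case True
    then show ?thesis using Cons.prems(2)[of "[]" b r] by simp
  next
    case False
    show ?thesis
    proof (rule Cons.IH)
      assume "\<forall>a\<in>set r. a \<le> y" "row_insert y r = (r @ [y], None)"
      then show ?thesis using Cons.prems(1) False by simp
    next
      fix A z B
      assume "r = A @ z # B" "\<forall>a\<in>set A. a \<le> y" "y < z" "row_insert y r = (A @ y # B, Some z)"
      then show ?thesis using Cons.prems(2)[of "b # A" z B] False by simp
    qed
  qed
qed

lemma row_insert_append_le:
  "\<forall>a\<in>set A. a \<le> y \<Longrightarrow> row_insert y (A @ B) = (A @ fst (row_insert y B), snd (row_insert y B))"
  by (induction A) (auto split: prod.splits)

lemma row_insert_append_bump: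
  "row_insert y A = (A', Some z) \<Longrightarrow> row_insert y (A @ B) = (A' @ B, Some z)"
  by (induction A arbitrary: A') (auto split: prod.splits if_splits)

lemma row_insert_all_le:
  "\<forall>a\<in>set A. a \<le> y \<Longrightarrow> row_insert y A = (A @ [y], None)"
  using row_insert_append_le[of A y "[]"] by simp

lemma row_insert_Some:
  assumes "row_insert y r = (r', Some z)"
  obtains A B where "r = A @ z # B" "r' = A @ y # B" "\<forall>a\<in>set A. a \<le> y" "y < z"
  by (rule row_insert_cases[of r y]) (use assms that in auto)

section \<open>Adjacent rows of a semistandard tableau\<close>

definition two_rows :: "nat list \<Rightarrow> nat list \<Rightarrow> bool" where
  "two_rows r s \<longleftrightarrow> sorted r \<and> sorted s \<and> length s \<le> length r \<and> (\<forall>i<length s. r ! i < s ! i)"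

lemma two_rows_Nil: "two_rows r [] \<longleftrightarrow> sorted r"
  by (simp add: two_rows_def)

lemma two_rows_Cons: "two_rows (a # r) (b # s) \<Longrightarrow> a < b \<and> two_rows r s"
  by (force simp: two_rows_def)

lemma two_rows_snoc:
  "two_rows r s \<Longrightarrow> length r = length s \<Longrightarrow> a < b \<Longrightarrow> \<forall>x\<in>set r. x \<le> a \<Longrightarrow> \<forall>x\<in>set s. x \<le> b
    \<Longrightarrow> two_rows (r @ [a]) (s @ [b])"
  by (auto simp: two_rows_def sorted_append nth_append less_Suc_eq)

lemma two_rows_append1:
  "two_rows r s \<Longrightarrow> \<forall>x\<in>set r. x \<le> a \<Longrightarrow> two_rows (r @ [a]) s"
  by (auto simp: two_rows_def sorted_append nth_append)

text \<open>The entry of \<open>s\<close> below the old cell of \<open>z\<close>, if any, exceeds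
  \<open>z\<close>, so \<open>z\<close> lands weakly left of that cell; there the new first row has
  entries at most \<open>y < z\<close>.\<close>

lemma two_rows_bump:
  assumes rs: "two_rows r s" and r': "row_insert y r = (r', Some z)" and s': "row_insert z s = (s', out)"
  shows "two_rows r' s'"
proof -
  obtain A B where r: "r = A @ z # B" and r'_eq: "r' = A @ y # B" and A: "\<forall>a\<in>set A. a \<le> y" and "y < z"
    using r' by (rule row_insert_Some)
  have len: "length r' = length r" using r r'_eq by simp
  have sorted_r': "sorted r'"
    using rs A \<open>y < z\<close> by (auto simp: two_rows_def r r'_eq sorted_append)
  have le: "r' ! i \<le> r ! i" if "i < length r" for i
    using that \<open>y < z\<close> by (auto simp: r r'_eq nth_append nth_Cons')
  have small: "r' ! i \<le> y" if "i \<le> length A" for i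
    using that A by (auto simp: r'_eq nth_append)
  have above: "s ! length A > z" if "length A < length s"
    using rs that by (auto simp: two_rows_def r dest!: spec[of _ "length A"])
  show ?thesis
  proof (rule row_insert_cases[of s z])
    assume le_z: "\<forall>a\<in>set s. a \<le> z" and "row_insert z s = (s @ [z], None)"
    then have s'_eq: "s' = s @ [z]" using s' by simp
    have lens: "length s \<le> length A"
      using above le_z by (meson leD leI nth_mem)
    have "r' ! i < s' ! i" if "i < length s'" for i
    proof (cases "i < length s")
      case True
      then have "i < length r" "r ! i < s ! i" using rs by (auto simp: two_rows_def)
      then show ?thesis using le[of i] True by (simp add: s'_eq nth_append)
    next
      case False
      then have "i = length s" using that s'_eq by simp
      then show ?thesis using small[of i] lens \<open>y < z\<close> by (simp add: s'_eq)
    qed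
    then show ?thesis
      using rs sorted_r' lens le_z by (auto simp: two_rows_def s'_eq sorted_append r'_eq)
  next
    fix E t F
    assume s: "s = E @ t # F" and E: "\<forall>a\<in>set E. a \<le> z" and "z < t"
      and "row_insert z s = (E @ z # F, Some t)"
    then have s'_eq: "s' = E @ z # F" using s' by simp
    have lens: "length E \<le> length A"
    proof (rule ccontr)
      assume "\<not> length E \<le> length A"
      then have "s ! length A \<in> set E" "length A < length s" by (auto simp: s nth_append)
      then show False using above E by fastforce
    qed
    have "r' ! i < s' ! i" if "i < length s'" for i
    proof (cases "i = length E")
      case True
      then show ?thesis using small[of i] lens \<open>y < z\<close> by (simp add: s'_eq)
    next
      case False
      then have "s' ! i = s ! i" by (auto simp: s s'_eq nth_append nth_Cons')
      moreover have "i < length s" using that by (simp add: s s'_eq)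
      then have "i < length r" "r ! i < s ! i" using rs by (auto simp: two_rows_def)
      ultimately show ?thesis using le[of i] by simp
    qed
    moreover have "sorted s'"
      using rs E \<open>z < t\<close> by (auto simp: two_rows_def s s'_eq sorted_append)
    ultimately show ?thesis
      using rs sorted_r' by (auto simp: two_rows_def s'_eq s len)
  qed
qed

section \<open>First two rows and the overflow below them\<close>

text \<open>The state after inserting a word consists of the first two rows and the word of letters
  bumped out of the second row.\<close>

fun bump2 :: "nat list \<times> nat list \<times> nat list \<Rightarrow> nat \<Rightarrow> nat list \<times> nat list \<times> nat list" where
  "bump2 (r, s, v) y =
     (case row_insert y r of
        (r', None) \<Rightarrow> (r', s, v)
      | (r', Some z) \<Rightarrow>
          (case row_insert z s of
             (s', None) \<Rightarrow> (r', s', v)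
           | (s', Some t) \<Rightarrow> (r', s', v @ [t])))"

definition top2 :: "nat list \<Rightarrow> nat list \<times> nat list \<times> nat list" where
  "top2 w = foldl bump2 ([], [], []) w"

lemma top2_Nil [simp]: "top2 [] = ([], [], [])"
  by (simp add: top2_def)

lemma top2_snoc: "top2 (w @ [y]) = bump2 (top2 w) y"
  by (simp add: top2_def)

lemma row_insert_set:
  "row_insert y r = (r', out) \<Longrightarrow> set r' \<union> set_option out = insert y (set r)"
  by (cases rule: row_insert_cases[of r y]) auto

lemma bump2_set:
  assumes "bump2 (r, s, v) y = (r', s', v')"
  shows "set r' \<union> set s' \<subseteq> insert y (set r \<union> set s)"
proof -
  obtain r1 out where 1: "row_insert y r = (r1, out)" by fastforce
  show ?thesis
  proof (cases out)
    case None
    then show ?thesis using assms 1 row_insert_set[OF 1] by auto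
  next
    case (Some z)
    obtain s1 out' where 2: "row_insert z s = (s1, out')" by fastforce
    have "r' = r1" "s' = s1" using assms 1 2 Some by (auto split: option.splits)
    then show ?thesis using row_insert_set[OF 1] row_insert_set[OF 2] Some by auto
  qed
qed

lemma top2_set: "top2 w = (r, s, v) \<Longrightarrow> set r \<union> set s \<subseteq> set w"
proof (induction w arbitrary: r s v rule: rev_induct)
  case (snoc y w)
  obtain r0 s0 v0 where w: "top2 w = (r0, s0, v0)" by (cases "top2 w") auto
  show ?case using snoc.IH[OF w] snoc.prems bump2_set[of r0 s0 v0 y r s v] by (auto simp: top2_snoc w)
qed simp

definition stack :: "nat list \<Rightarrow> nat list \<Rightarrow> nat list list \<Rightarrow> nat list list" where
  "stack r s T = (if r = [] then [] else if s = [] then [r] else r # s # T)"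

lemma insertion_tableau_Nil [simp]: "insertion_tableau [] = []"
  by (simp add: insertion_tableau_def)

lemma insertion_tableau_snoc [simp]:
  "insertion_tableau (w @ [y]) = tableau_insert (insertion_tableau w) y"
  by (simp add: insertion_tableau_def)

text \<open>The lower rows only ever receive the letters bumped out of the second row, in that
  order, so they form \<open>insertion_tableau v\<close>. The emptiness clauses ensure that
  \<open>stack\<close> discards nothing.\<close>

lemma insertion_tableau_stack:
  "top2 w = (r, s, v) \<Longrightarrow>
     insertion_tableau w = stack r s (insertion_tableau v) \<and> (r = [] \<longrightarrow> s = []) \<and> (s = [] \<longrightarrow> v = [])"
proof (induction w arbitrary: r s v rule: rev_induct)
  case Nil
  then show ?case by (simp add: stack_def)
next
  case (snoc y w)
  obtain r0 s0 v0 where w: "top2 w = (r0, s0, v0)" by (cases "top2 w") auto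
  have T: "insertion_tableau w = stack r0 s0 (insertion_tableau v0)"
    and r0: "r0 = [] \<longrightarrow> s0 = []" and s0: "s0 = [] \<longrightarrow> v0 = []"
    using snoc.IH[OF w] by auto
  have step: "bump2 (r0, s0, v0) y = (r, s, v)" using snoc.prems by (simp add: top2_snoc w)
  show ?case
  proof (cases rule: row_insert_cases[of r0 y])
    case append
    then have "r = r0 @ [y]" "s = s0" "v = v0" using step by auto
    then show ?thesis using append T r0 s0 by (auto simp: stack_def)
  next
    case (bump A z B)
    note r_bump = this
    show ?thesis
    proof (cases rule: row_insert_cases[of s0 z])
      case append
      then have "r = A @ y # B" "s = s0 @ [z]" "v = v0" using step r_bump by auto
      then show ?thesis using append r_bump T r0 s0 by (cases "s0 = []") (auto simp: stack_def)
    next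
      case (bump C t D)
      then have "r = A @ y # B" "s = C @ z # D" "v = v0 @ [t]" using step r_bump by auto
      then show ?thesis using bump r_bump T by (simp add: stack_def)
    qed
  qed
qed

section \<open>Semistandard shape, singleton columns and size\<close>

fun tableau :: "nat list list \<Rightarrow> bool" where
  "tableau [] = True"
| "tableau [r] = sorted r"
| "tableau (r # s # T) = (two_rows r s \<and> tableau (s # T))"

lemma tableau_tableau_insert: "tableau (r # T) \<Longrightarrow> tableau (tableau_insert (r # T) y)"
proof (induction T arbitrary: r y)
  case Nil
  show ?case
  proof (cases rule: row_insert_cases[of r y])
    case append
    then show ?thesis using Nil by (simp add: sorted_append)
  next
    case (bump A z B)
    \<comment> \<open>An empty second row is a valid neighbour, so starting a new row is an instance
      of \<open>two_rows_bump\<close>.\<close>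
    then show ?thesis using Nil two_rows_bump[OF _ bump(4), of "[]" "[z]" None] by (simp add: two_rows_Nil)
  qed
next
  case (Cons s T)
  show ?case
  proof (cases rule: row_insert_cases[of r y])
    case append
    then show ?thesis using Cons.prems by (simp add: two_rows_append1)
  next
    case (bump A z B)
    obtain s' out where s': "row_insert z s = (s', out)" by fastforce
    obtain T' where "tableau_insert (s # T) z = s' # T'" using s' by (cases out) auto
    then show ?thesis
      using Cons.IH[of s z] Cons.prems bump two_rows_bump[OF _ bump(4) s'] by simp
  qed
qed

lemma tableau_insertion_tableau: "tableau (insertion_tableau w)"
proof (induction w rule: rev_induct)
  case (snoc y w)
  then show ?case by (cases "insertion_tableau w") (auto simp: tableau_tableau_insert simp del: tableau_insert.simps(2))
qed simp

lemma tableau_length_le: "tableau (r # T) \<Longrightarrow> t \<in> set T \<Longrightarrow> length t \<le> length r"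
proof (induction T arbitrary: r)
  case (Cons s T)
  then show ?case by (fastforce simp: two_rows_def)
qed simp

lemma top2_two_rows: "top2 w = (r, s, v) \<Longrightarrow> two_rows r s"
  using insertion_tableau_stack[of w r s v] tableau_insertion_tableau[of w]
  by (auto simp: stack_def two_rows_Nil split: if_splits)

lemma foldr_max_le:
  "\<forall>t\<in>set T. length t \<le> n \<Longrightarrow> foldr (\<lambda>xs. max (length xs)) T 0 \<le> n"
  by (induction T) auto

lemma count_list_map_singleton: "count_list (map (\<lambda>x. [x]) xs) [a] = count_list xs a"
  by (induction xs) auto

text \<open>A column has length one exactly when it lies beyond the second row, so the singleton
  columns are the entries of the tail of \<open>r\<close>.\<close>

lemma singleton_columns_top2:
  assumes "top2 w = (r, s, v)"
  shows "singleton_columns a w = count_list (drop (length s) r) a"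
proof (cases "r = []")
  case True
  then show ?thesis
    using insertion_tableau_stack[OF assms] by (simp add: stack_def singleton_columns_def)
next
  case False
  define T where "T = insertion_tableau w"
  define T' where "T' = (if s = [] then [] else s # insertion_tableau v)"
  have T: "T = r # T'"
    using insertion_tableau_stack[OF assms] False by (simp add: stack_def T_def T'_def)
  have s_le: "length s \<le> length r" using top2_two_rows[OF assms] by (simp add: two_rows_def)
  have T'_le: "\<forall>t\<in>set T'. length t \<le> length s"
  proof (cases "s = []")
    case False
    then have "tableau (s # insertion_tableau v)"
      using tableau_insertion_tableau[of w] T by (simp add: T_def T'_def)
    then show ?thesis using tableau_length_le by (auto simp: T'_def)
  qed (simp add: T'_def)
  have len: "length (transpose T) = length r"
    using foldr_max_le[OF T'_le] s_le by (simp add: length_transpose T)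
  have nth: "transpose T ! i = map (\<lambda>t. t ! i) [t\<leftarrow>T. i < length t]" if "i < length r" for i
    using nth_transpose[of i T] that len by simp
  have drop: "drop (length s) (transpose T) = map (\<lambda>x. [x]) (drop (length s) r)"
  proof (rule nth_equalityI)
    fix i assume "i < length (drop (length s) (transpose T))"
    then have i: "length s + i < length r" using len by simp
    have "[t\<leftarrow>T'. length s + i < length t] = []" using T'_le by (fastforce simp: filter_empty_conv)
    then have "[t\<leftarrow>T. length s + i < length t] = [r]" using i by (simp add: T)
    then show "drop (length s) (transpose T) ! i = map (\<lambda>x. [x]) (drop (length s) r) ! i"
      using i len s_le nth[OF i] by simp
  qed (simp add: len)
  \<comment> \<open>Each of these columns has a cell in \<open>r\<close> and a cell in
    \<open>s\<close>.\<close>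
  have "[a] \<notin> set (take (length s) (transpose T))"
  proof
    assume "[a] \<in> set (take (length s) (transpose T))"
    then obtain i where i: "i < length s" "transpose T ! i = [a]"
      using len s_le by (auto simp: in_set_conv_nth)
    then have "length [t\<leftarrow>T. i < length t] = 1" using nth[of i] s_le by (metis length_map length_Cons list.size(3) One_nat_def order_less_le_trans)
    moreover have "T' = s # insertion_tableau v" using i by (auto simp: T'_def)
    ultimately show False using i s_le by (simp add: T)
  qed
  then have "count_list (take (length s) (transpose T)) [a] = 0" by (simp add: count_list_0_iff)
  then have "count_list (transpose T) [a] = count_list (drop (length s) (transpose T)) [a]"
    by (metis append_take_drop_id count_list_append add_0)
  then show ?thesis by (simp add: singleton_columns_def T_def[symmetric] drop count_list_map_singleton)
qed

lemma size_tableau_insert: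
  "sum_list (map length (tableau_insert T y)) = Suc (sum_list (map length T))"
proof (induction T arbitrary: y)
  case (Cons r T)
  then show ?case by (cases rule: row_insert_cases[of r y]) auto
qed simp

lemma size_insertion_tableau: "sum_list (map length (insertion_tableau w)) = length w"
  by (induction w rule: rev_induct) (auto simp: size_tableau_insert)

text \<open>Equal tableaux determine \<open>v\<close> only up to its insertion tableau. The length
  is still determined, which suffices when one overflow word is a prefix of the other.\<close>

lemma stack_eqD:
  assumes "insertion_tableau w = insertion_tableau w'" "top2 w = (r, s, v)" "top2 w' = (r', s', v')"
  shows "r = r' \<and> s = s' \<and> length v = length v'"
proof -
  have "r = r' \<and> s = s' \<and> insertion_tableau v = insertion_tableau v'"
    using insertion_tableau_stack[OF assms(2)] insertion_tableau_stack[OF assms(3)] assms(1)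
    by (auto simp: stack_def split: if_splits)
  then show ?thesis by (metis size_insertion_tableau)
qed

section \<open>Left multiplication as a slide\<close>

text \<open>Prepending \<open>x\<close> to a word acts on the first two rows as a slide: \<open>x\<close> enters the second row
  from the left, and either the second row becomes longer or some entry \<open>c\<close> moves up.\<close>

definition slide :: "nat \<Rightarrow> nat list \<Rightarrow> nat list \<Rightarrow> nat list \<Rightarrow> nat list \<Rightarrow> bool" where
  "slide x r s r' s' \<longleftrightarrow>
     r' = r \<and> s' = x # s \<or>
     (\<exists>A B C c D. r = A @ B \<and> x # s = C @ c # D \<and> r' = A @ c # B \<and> s' = C @ D \<and>
        length A = length C \<and> sorted (A @ c # B) \<and> sorted (C @ c # D) \<and> two_rows A C \<and> two_rows B D)"

lemma slideI:
  assumes "r = A @ B" "x # s = C @ c # D" "r' = A @ c # B" "s' = C @ D"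
    "length A = length C" "sorted (A @ c # B)" "sorted (C @ c # D)" "two_rows A C" "two_rows B D"
  shows "slide x r s r' s'"
  unfolding slide_def using assms by blast

lemma bump2_None: "row_insert y r = (r', None) \<Longrightarrow> bump2 (r, s, v) y = (r', s, v)"
  by simp

lemma bump2_Some:
  "row_insert y r = (r', Some z) \<Longrightarrow> row_insert z s = (s', t) \<Longrightarrow>
     bump2 (r, s, v) y = (r', s', v @ (case t of None \<Rightarrow> [] | Some t \<Rightarrow> [t]))"
  by (simp split: option.splits)

lemma row_insert_Cons_le:
  "x \<le> z \<Longrightarrow> row_insert z (x # s) = (x # fst (row_insert z s), snd (row_insert z s))"
  by (simp split: prod.splits)

text \<open>Slides commute with row insertion, and both states emit the same overflow. The bound on
  \<open>x\<close> gives \<open>x \<le> z\<close> for each \<open>z > y\<close> bumped from the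
  first row, so \<open>x\<close> stays at the head of the extended second row.\<close>

lemma slide_bump2:
  assumes "slide x r s r' s'" "x \<le> Suc y"
  shows "\<exists>q t q' t' o'. bump2 (r, s, v) y = (q, t, v @ o') \<and> bump2 (r', s', v) y = (q', t', v @ o') \<and> slide x q t q' t'"
  using assms(1)[unfolded slide_def]
proof (elim disjE conjE exE)
  assume eq: "r' = r" "s' = x # s"
  show ?thesis
  proof (cases rule: row_insert_cases[of r y])
    case append
    then show ?thesis using eq by (auto simp: slide_def)
  next
    case (bump A z B)
    have "x \<le> z" using bump assms(2) by simp
    obtain t out where t: "row_insert z s = (t, out)" by fastforce
    have "row_insert z (x # s) = (x # t, out)" using \<open>x \<le> z\<close> by (simp add: row_insert_Cons_le t)
    then show ?thesis
      using bump2_Some[OF bump(4) t, of v] bump2_Some[OF bump(4), of "x # s" "x # t" out v] eq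
      unfolding slide_def by blast
  qed
next
  fix A B C c D
  assume r: "r = A @ B" and s: "x # s = C @ c # D" and r': "r' = A @ c # B" and s': "s' = C @ D"
    and len: "length A = length C" and sr: "sorted (A @ c # B)" and ss: "sorted (C @ c # D)"
    and AC: "two_rows A C" and BD: "two_rows B D"
  \<comment> \<open>Inserting \<open>z\<close> into \<open>s\<close> amounts to inserting it into
    \<open>C @ c # D\<close> and then removing the leading \<open>x\<close>.\<close>
  have s_ins: "x # fst (row_insert z s) = fst (row_insert z (C @ c # D)) \<and>
      snd (row_insert z s) = snd (row_insert z (C @ c # D))" if "x \<le> z" for z
    using row_insert_Cons_le[OF that, of s] s by simp
  have "x \<le> c" using s ss by (cases C) auto
  \<comment> \<open>In \<open>r'\<close>, the letter \<open>y\<close> acts to the right of the entry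
    \<open>c\<close> that moved up, bumps \<open>c\<close> itself, or acts to its left.\<close>
  consider (right) "c \<le> y" | (mid) "y < c" "\<forall>a\<in>set A. a \<le> y" | (left) "\<not> (\<forall>a\<in>set A. a \<le> y)"
    by fastforce
  then show ?thesis
  proof cases
    case right
    have A: "\<forall>a\<in>set A. a \<le> y" and C: "\<forall>a\<in>set C. a \<le> c" using sr ss right by (auto simp: sorted_append)
    have Ac: "\<forall>a\<in>set (A @ [c]). a \<le> y" using A right by simp
    show ?thesis
    proof (cases rule: row_insert_cases[of B y])
      case append
      have 1: "row_insert y r = (A @ B @ [y], None)" using row_insert_append_le[OF A, of B] append r by simp
      have 2: "row_insert y r' = (A @ c # B @ [y], None)"
        using row_insert_append_le[OF Ac, of B] append r' by simp
      have "slide x (A @ B @ [y]) s (A @ c # B @ [y]) s'"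
        using s s' len sr ss AC BD append right A
        by (intro slideI[where A = A and B = "B @ [y]" and C = C and c = c and D = D])
          (auto simp: sorted_append intro: two_rows_append1)
      then show ?thesis using bump2_None[OF 1, of s v] bump2_None[OF 2, of s' v]
        by (metis append_Nil2)
    next
      case (bump E z F)
      have "c < z" using bump right by simp
      have "x \<le> z" using \<open>x \<le> c\<close> \<open>c < z\<close> by simp
      obtain D' out where D': "row_insert z D = (D', out)" by fastforce
      have C': "\<forall>a\<in>set C. a \<le> z" "\<forall>a\<in>set (C @ [c]). a \<le> z" using C \<open>c < z\<close> by auto
      have cD: "row_insert z (C @ c # D) = (C @ c # D', out)"
        using row_insert_append_le[OF C'(2), of D] D' by simp
      have 1: "row_insert y r = (A @ E @ y # F, Some z)" using row_insert_append_le[OF A, of B] bump r by simp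
      have 2: "row_insert y r' = (A @ c # E @ y # F, Some z)"
        using row_insert_append_le[OF Ac, of B] bump r' by simp
      obtain t where 3: "row_insert z s = (t, out)" and t: "x # t = C @ c # D'"
        using s_ins[OF \<open>x \<le> z\<close>] cD by (cases "row_insert z s") auto
      have 4: "row_insert z s' = (C @ D', out)" using row_insert_append_le[OF C'(1), of D] D' s' by simp
      have BD': "two_rows (E @ y # F) D'" using two_rows_bump[OF BD bump(4) D'] .
      have setD': "set D' \<subseteq> insert z (set D)" using row_insert_set[OF D'] by auto
      have "slide x (A @ E @ y # F) t (A @ c # E @ y # F) (C @ D')"
      proof (rule slideI[where A = A and B = "E @ y # F" and C = C and c = c and D = D'])
        show "sorted (A @ c # E @ y # F)"
          using sr BD' A right bump by (auto simp: sorted_append two_rows_def)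
        show "sorted (C @ c # D')"
          using ss BD' \<open>c < z\<close> setD' C' by (fastforce simp: sorted_append two_rows_def)
      qed (use t len AC BD' in auto)
      then show ?thesis using bump2_Some[OF 1 3, of v] bump2_Some[OF 2 4, of v] by blast
    qed
  next
    case mid
    have 2: "row_insert y r' = (A @ y # B, Some c)"
      using row_insert_append_le[OF mid(2), of "c # B"] mid(1) r' by simp
    have C: "\<forall>a\<in>set C. a \<le> c" using ss by (auto simp: sorted_append)
    show ?thesis
    proof (cases B)
      case Nil
      \<comment> \<open>In \<open>r'\<close> the letter \<open>y\<close> pushes \<open>c\<close>
        back down to the end of \<open>C\<close>, which restores \<open>x # s\<close>: the slide
        becomes the one that only lengthens the second row.\<close>
      then have D: "D = []" using BD by (simp add: two_rows_def)
      have 1: "row_insert y r = (A @ [y], None)" using row_insert_all_le[OF mid(2)] r Nil by simp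
      have 3: "row_insert c s' = (C @ [c], None)" using row_insert_all_le[OF C] s' D by simp
      show ?thesis
        using bump2_None[OF 1, of s v] bump2_Some[OF 2 3, of v] Nil s D unfolding slide_def
        by (metis append_Nil2 option.simps(4))
    next
      case (Cons e B')
      \<comment> \<open>In \<open>r\<close> the letter \<open>y\<close> bumps \<open>e\<close>, so
        afterwards it is \<open>e\<close> that moves up, one column further right.\<close>
      have ce: "c \<le> e" using sr Cons by (auto simp: sorted_append)
      have "x \<le> e" using \<open>x \<le> c\<close> ce by simp
      have 1: "row_insert y r = (A @ y # B', Some e)"
        using row_insert_append_le[OF mid(2), of B] mid ce r Cons by simp
      have Ce: "\<forall>a\<in>set (C @ [c]). a \<le> e" using C ce by auto
      \<comment> \<open>\<open>c\<close> and \<open>e\<close> both bump the head of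
        \<open>D\<close>, as \<open>c \<le> e\<close> and column strictness makes that head larger
        than \<open>e\<close>. If \<open>D\<close> is empty, both are appended, and
        \<open>tl [] = []\<close> fits.\<close>
      define D' where "D' = tl D"
      define out where "out = (case D of [] \<Rightarrow> None | d # _ \<Rightarrow> Some d)"
      have De: "row_insert e D = (e # D', out)" and Dc: "row_insert c D = (c # D', out)"
        and B'D': "two_rows B' D'" and D'e: "\<forall>a\<in>set D'. e \<le> a"
      proof -
        have "row_insert e D = (e # D', out) \<and> row_insert c D = (c # D', out) \<and> two_rows B' D' \<and> (\<forall>a\<in>set D'. e \<le> a)"
        proof (cases D)
          case Nil
          then show ?thesis using BD Cons by (simp add: D'_def out_def two_rows_def)
        next
          case (Cons d D1)
          then have "e < d \<and> two_rows B' D1" using BD \<open>B = e # B'\<close> two_rows_Cons by blast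
          then show ?thesis using Cons ce ss by (auto simp: D'_def out_def sorted_append)
        qed
        then show "row_insert e D = (e # D', out)" "row_insert c D = (c # D', out)" "two_rows B' D'" "\<forall>a\<in>set D'. e \<le> a"
          by auto
      qed
      have "row_insert e (C @ c # D) = (C @ c # e # D', out)"
        using row_insert_append_le[OF Ce, of D] De by simp
      then obtain t where 3: "row_insert e s = (t, out)" and t: "x # t = C @ c # e # D'"
        using s_ins[OF \<open>x \<le> e\<close>] by (cases "row_insert e s") auto
      have 4: "row_insert c s' = (C @ c # D', out)" using row_insert_append_le[OF C, of D] Dc s' by simp
      have "slide x (A @ y # B') t (A @ y # B) (C @ c # D')"
      proof (rule slideI[where A = "A @ [y]" and B = B' and C = "C @ [c]" and c = e and D = D'])
        show "sorted ((A @ [y]) @ e # B')" using sr mid ce Cons by (auto simp: sorted_append)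
        have "a \<le> b" if "a \<in> set C" "b \<in> set D'" for a b
          using C ce D'e that order_trans by metis
        then show "sorted ((C @ [c]) @ e # D')"
          using C ce D'e B'D' ss by (auto simp: sorted_append two_rows_def dest: order_trans[OF ce])
        show "two_rows (A @ [y]) (C @ [c])" using two_rows_snoc[OF AC len mid(1,2) C] .
      qed (use t len B'D' Cons in auto)
      then show ?thesis using bump2_Some[OF 1 3, of v] bump2_Some[OF 2 4, of v] by blast
    qed
  next
    case left
    show ?thesis
    proof (cases rule: row_insert_cases[of A y])
      case append
      then show ?thesis using left by simp
    next
      case (bump E z F)
      have "x \<le> z" using bump assms(2) by simp
      have "z \<le> c" using sr bump by (auto simp: sorted_append)
      \<comment> \<open>The entry of \<open>C\<close> below the bumped \<open>z\<close> exceeds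
        \<open>z\<close>, so the second bump also happens inside \<open>C\<close> and
        \<open>c\<close> stays in place.\<close>
      have "length E < length C" using bump len by simp
      then have "z < C ! length E" using AC bump by (auto simp: two_rows_def dest: spec[of _ "length E"])
      then have "\<not> (\<forall>a\<in>set C. a \<le> z)" using \<open>length E < length C\<close> nth_mem leD by blast
      then obtain C' t where C': "row_insert z C = (C', Some t)"
        by (cases rule: row_insert_cases[of C z]) auto
      have lenC': "length C' = length C" using C' by (auto elim!: row_insert_Some)
      have AC': "two_rows (E @ y # F) C'" using two_rows_bump[OF AC bump(4) C'] .
      have 1: "row_insert y r = (E @ y # F @ B, Some z)"
        using row_insert_append_bump[OF bump(4), of B] r by simp
      have 2: "row_insert y r' = (E @ y # F @ c # B, Some z)"
        using row_insert_append_bump[OF bump(4), of "c # B"] r' by simp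
      obtain s1 where 3: "row_insert z s = (s1, Some t)" and s1: "x # s1 = C' @ c # D"
        using s_ins[OF \<open>x \<le> z\<close>] row_insert_append_bump[OF C', of "c # D"] by (cases "row_insert z s") auto
      have 4: "row_insert z s' = (C' @ D, Some t)" using row_insert_append_bump[OF C', of D] s' by simp
      have setC': "set C' \<subseteq> insert z (set C)" using row_insert_set[OF C'] by auto
      have "slide x (E @ y # F @ B) s1 (E @ y # F @ c # B) (C' @ D)"
      proof (rule slideI[where A = "E @ y # F" and B = B and C = C' and c = c and D = D])
        show "sorted ((E @ y # F) @ c # B)"
          using sr AC' bump by (auto simp: sorted_append two_rows_def)
        show "sorted (C' @ c # D)"
          using ss AC' setC' \<open>z \<le> c\<close> by (fastforce simp: sorted_append two_rows_def)
      qed (use s1 len lenC' bump AC' BD in auto)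
      then show ?thesis using bump2_Some[OF 1 3, of v] bump2_Some[OF 2 4, of v] by blast
    qed
  qed
qed

text \<open>The slide arises on the empty word, where \<open>x\<close> moves straight up, and is
  carried through the letters of \<open>w\<close>. For positive letters the bound holds whenever
  \<open>x \<le> 2\<close>.\<close>

lemma top2_Cons:
  assumes "\<forall>y\<in>set w. x \<le> Suc y" "top2 w = (r, s, v)"
  shows "\<exists>r' s'. top2 (x # w) = (r', s', v) \<and> slide x r s r' s'"
  using assms
proof (induction w arbitrary: r s v rule: rev_induct)
  case Nil
  then show ?case
    using slideI[of "[]" "[]" "[]" x "[]" "[]" x "[]"] by (simp add: top2_def two_rows_def)
next
  case (snoc y w)
  obtain r0 s0 v0 where w: "top2 w = (r0, s0, v0)" by (cases "top2 w") auto
  then obtain r1 s1 where xw: "top2 (x # w) = (r1, s1, v0)" "slide x r0 s0 r1 s1"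
    using snoc by auto
  show ?case
    using slide_bump2[OF xw(2), of y v0] snoc.prems top2_snoc[of "x # w" y] w xw(1)
    by (auto simp: top2_snoc)
qed

section \<open>Commutation keeps letters above 2 out of the first two rows\<close>

lemma top2_append: "top2 (w @ u) = foldl bump2 (top2 w) u"
  by (simp add: top2_def)

lemma foldl_bump2_out: "foldl bump2 (r, s, v) u = (r', s', v') \<Longrightarrow> \<exists>v1. v' = v @ v1"
proof (induction u arbitrary: r s v)
  case (Cons x u)
  obtain r1 s1 v1 where 1: "bump2 (r, s, v) x = (r1, s1, v1)" by (cases "bump2 (r, s, v) x") auto
  then have "\<exists>v2. v1 = v @ v2" by (auto split: prod.splits option.splits)
  then show ?case using Cons 1 by fastforce
qed simp

definition num_big :: "nat list \<Rightarrow> nat" where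
  "num_big r = length [a\<leftarrow>r. 2 < a]"

lemma num_big_eq_0: "num_big r = 0 \<longleftrightarrow> (\<forall>a\<in>set r. a \<le> 2)"
  by (auto simp: num_big_def filter_empty_conv)

text \<open>A 2 bumps an entry above 2 whenever there is one, whereas a 1 may bump a 2
  instead.\<close>

lemma num_big_bump2:
  assumes "bump2 (r, s, v) x = (r', s', v')" "x \<le> 2"
  shows "num_big r' \<le> num_big r \<and> (x = 2 \<longrightarrow> 0 < num_big r \<longrightarrow> num_big r' < num_big r)"
proof (cases rule: row_insert_cases[of r x])
  case append
  then show ?thesis using assms by (auto simp: num_big_def filter_empty_conv)
next
  case (bump A z B)
  then have "r' = A @ x # B" using assms by (auto split: prod.splits option.splits)
  then show ?thesis using bump assms by (auto simp: num_big_def)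
qed

lemma num_big_foldl_bump2:
  assumes "foldl bump2 (r, s, v) u = (r', s', v')" "\<forall>x\<in>set u. x \<le> 2"
  shows "num_big r' \<le> num_big r \<and> (2 \<in> set u \<longrightarrow> 0 < num_big r \<longrightarrow> num_big r' < num_big r)"
  using assms
proof (induction u arbitrary: r s v)
  case (Cons x u)
  obtain r1 s1 v1 where 1: "bump2 (r, s, v) x = (r1, s1, v1)" by (cases "bump2 (r, s, v) x") auto
  have "num_big r' \<le> num_big r1 \<and> (2 \<in> set u \<longrightarrow> 0 < num_big r1 \<longrightarrow> num_big r' < num_big r1)"
    using Cons 1 by simp
  then show ?case using num_big_bump2[OF 1] Cons.prems by fastforce
qed simp

lemma slide_fst:
  "slide x r s r' s' \<Longrightarrow> num_big r \<le> num_big r' \<and> length r' \<le> Suc (length r)"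
  by (auto simp: slide_def num_big_def)

lemma top2_prepend:
  assumes "\<forall>y\<in>set w. 1 \<le> y" "set u \<subseteq> {1, 2}" "top2 w = (r, s, v)"
  shows "\<exists>r' s'. top2 (u @ w) = (r', s', v) \<and> num_big r \<le> num_big r' \<and> length r' \<le> length r + length u"
  using assms(2)
proof (induction u)
  case Nil
  then show ?case using assms by simp
next
  case (Cons x u)
  then obtain r1 s1 where 1: "top2 (u @ w) = (r1, s1, v)" "num_big r \<le> num_big r1" "length r1 \<le> length r + length u"
    by auto
  have "\<forall>y\<in>set (u @ w). x \<le> Suc y" using Cons.prems assms(1) by fastforce
  then obtain r2 s2 where "top2 (x # u @ w) = (r2, s2, v)" "slide x r1 s1 r2 s2"
    using top2_Cons[OF _ 1(1)] by blast
  then show ?case using slide_fst[of x r1 s1 r2 s2] 1 by auto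
qed

text \<open>A bump in the first row would release a 2, which would displace an entry of
  \<open>s\<close> because of \<open>z\<close>, and so lengthen the overflow. Hence every letter is
  appended to the first row.\<close>

lemma foldl_bump2_no_output:
  assumes "foldl bump2 (r, s, v) u = (r', s', v)" "\<forall>a\<in>set r. a \<le> 2" "\<forall>x\<in>set u. 1 \<le> x \<and> x \<le> 2"
    and "z \<in> set s" "2 < z"
  shows "r' = r @ u"
  using assms(1-3)
proof (induction u arbitrary: r)
  case (Cons x u)
  show ?case
  proof (cases rule: row_insert_cases[of r x])
    case append
    then show ?thesis using Cons.IH[of "r @ [x]"] Cons.prems by simp
  next
    case (bump A b B)
    note r_bump = this
    then have b: "b = 2" using Cons.prems by auto
    show ?thesis
    proof (cases rule: row_insert_cases[of s b])
      case append
      then show ?thesis using assms(4,5) b by auto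
    next
      case (bump C t D)
      then have "foldl bump2 (A @ x # B, C @ b # D, v @ [t]) u = (r', s', v)"
        using r_bump Cons.prems by simp
      then show ?thesis using foldl_bump2_out by fastforce
    qed
  qed
qed simp

lemma commute_two_rows_small:
  assumes eq: "insertion_tableau (u @ w) = insertion_tableau (w @ u)"
    and u: "set u = {1, 2}" and w: "\<forall>y\<in>set w. 1 \<le> y" and top: "top2 w = (r, s, v)"
  shows "set r \<union> set s \<subseteq> {1, 2}"
proof -
  have rs1: "\<forall>a\<in>set r \<union> set s. 1 \<le> a" using top2_set[OF top] w by auto
  obtain r' s' where L: "top2 (u @ w) = (r', s', v)" "num_big r \<le> num_big r'"
    using top2_prepend[OF w _ top, of u] u by auto
  obtain r'' s'' v'' where R: "foldl bump2 (r, s, v) u = (r'', s'', v'')"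
    by (cases "foldl bump2 (r, s, v) u") auto
  then have "top2 (w @ u) = (r'', s'', v'')" by (simp add: top2_append top)
  note e = stack_eqD[OF eq L(1) this]
  \<comment> \<open>\<open>v''\<close> extends \<open>v\<close> and has the same length.\<close>
  obtain v1 where "v'' = v @ v1" using foldl_bump2_out[OF R] by blast
  then have R': "foldl bump2 (r, s, v) u = (r', s', v)" using e R by simp
  \<comment> \<open>Left multiplication by \<open>u\<close> does not decrease
    \<open>num_big\<close>; right multiplication decreases it strictly unless it is 0, since
    \<open>u\<close> contains a 2.\<close>
  have "num_big r = 0" using num_big_foldl_bump2[OF R'] L(2) u by fastforce
  then have r2: "\<forall>a\<in>set r. a \<le> 2" by (simp add: num_big_eq_0)
  have "\<forall>a\<in>set s. a \<le> 2"
  proof (rule ccontr)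
    assume "\<not> (\<forall>a\<in>set s. a \<le> 2)"
    then obtain z where z: "z \<in> set s" "2 < z" by auto
    have r': "r' = r @ u" using foldl_bump2_no_output[OF R' r2 _ z] u by auto
    \<comment> \<open>As \<open>u\<close> contains both letters and \<open>r @ u\<close> is sorted,
      \<open>r\<close> consists of 1s and \<open>u\<close> ends in 2.\<close>
    have sorted: "sorted (r @ u)" using top2_two_rows[OF L(1)] r' by (simp add: two_rows_def)
    then have "\<forall>a\<in>set r. a \<le> 1" using u by (simp add: sorted_append)
    then have r1: "\<forall>a\<in>set r. a = 1" using rs1 by (simp add: le_antisym)
    have "u \<noteq> []" using u by auto
    then obtain p x where px: "u = p @ [x]" by (meson rev_exhaust)
    have "x \<in> set u" "set u = insert x (set p)" by (simp_all add: px)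
    then have "x \<in> {1, 2}" "2 \<in> insert x (set p)" using u by blast+
    moreover have "\<forall>a\<in>set p. a \<le> x" using sorted by (simp add: px sorted_append)
    ultimately have "x = 2" by force
    have w2: "\<forall>y\<in>set w. 2 \<le> Suc y" using w by auto
    obtain r1 s1 where 1: "top2 (2 # w) = (r1, s1, v)" "slide 2 r s r1 s1"
      using top2_Cons[OF w2 top] by blast
    have "\<forall>y\<in>set (2 # w). 1 \<le> y" using w by simp
    then have p: "num_big r1 \<le> num_big r'" "length r' \<le> length r1 + length p"
      using top2_prepend[OF _ _ 1(1), of p] u L(1) px \<open>x = 2\<close> by auto
    have "num_big r' = 0" using r' r2 u by (simp add: num_big_eq_0)
    then have "num_big r1 = 0" using p by simp
    then have r1_le: "\<forall>a\<in>set r1. a \<le> 2" by (simp add: num_big_eq_0)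
    \<comment> \<open>The final 2 of \<open>u\<close> is the first letter slid into
      \<open>P(w)\<close>. The first row gains \<open>length u\<close> cells in all and each letter
      adds at most one, so already this slide lengthens it.\<close>
    have "length r1 > length r" using p r' px by simp
    then obtain A B C c D where AB: "r = A @ B" "2 # s = C @ c # D" "r1 = A @ c # B"
        "sorted (A @ c # B)" "sorted (C @ c # D)" "two_rows B D"
      using 1(2) unfolding slide_def by auto
    \<comment> \<open>An entry \<open>c \<ge> 2\<close> can only stand after the 1s of
      \<open>r\<close>, so it comes from the end of the second row and is at least \<open>z\<close>.
      This puts an entry above 2 into \<open>r1\<close>.\<close>
    have "c \<ge> 2" using AB(2,5) by (cases C) (auto simp: sorted_append)
    then have "B = []" using AB(1,4) r1 by (cases B) (auto simp: sorted_append)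
    then have "D = []" using AB(6) by (simp add: two_rows_def)
    have "z \<in> set (C @ [c])" using z AB(2) \<open>D = []\<close> by (metis list.set_intros(2))
    then have "c \<ge> z" using AB(5) by (auto simp: sorted_append)
    then show False using r1_le AB(3) z(2) by auto
  qed
  then have "\<forall>a\<in>set r \<union> set s. 1 \<le> a \<and> a \<le> 2" using r2 rs1 by blast
  moreover have "a \<in> {1, 2}" if "1 \<le> a \<and> a \<le> 2" for a :: nat using that by auto
  ultimately show ?thesis by blast
qed

section \<open>Two-letter rows and the matching of 2s with later 1s\<close>

text \<open>Here \<open>p\<close> and \<open>q\<close> are the numbers of singleton columns \<open>1\<close> and \<open>2\<close>, and \<open>k\<close> is the number
  of columns starting with \<open>1, 2\<close>.\<close>

definition rows12 :: "nat \<Rightarrow> nat \<Rightarrow> nat \<Rightarrow> nat list \<Rightarrow> nat list \<times> nat list \<times> nat list" where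
  "rows12 p q k v = (replicate (p + k) 1 @ replicate q 2, replicate k 2, v)"

lemma count_list_replicate: "count_list (replicate n x) y = (if x = y then n else 0)"
  by (induction n) auto

lemma rows12_eqD: "rows12 p q k v = rows12 p' q' k' v' \<Longrightarrow> p = p' \<and> q = q' \<and> k = k'"
proof -
  assume "rows12 p q k v = rows12 p' q' k' v'"
  then have 1: "replicate (p + k) (1::nat) @ replicate q 2 = replicate (p' + k') 1 @ replicate q' 2"
    and k: "k = k'" by (auto simp: rows12_def dest: arg_cong[of _ _ length])
  from arg_cong[OF 1, of "\<lambda>l. count_list l 1"] arg_cong[OF 1, of "\<lambda>l. count_list l 2"]
  show ?thesis using k by (simp add: count_list_replicate)
qed

lemma sorted_12:
  "sorted r \<Longrightarrow> set r \<subseteq> {1, 2::nat} \<Longrightarrow> \<exists>m q. r = replicate m 1 @ replicate q 2"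
proof (induction r)
  case (Cons a r)
  then obtain m q where r: "r = replicate m 1 @ replicate q 2" by auto
  show ?case
  proof (cases "a = 1")
    case True
    then have "a # r = replicate (Suc m) 1 @ replicate q 2" using r by simp
    then show ?thesis by blast
  next
    case False
    then have a: "a = 2" using Cons.prems by auto
    then have "m = 0" using Cons.prems r by (cases m) auto
    then have "a # r = replicate 0 1 @ replicate (Suc q) 2" using r a by simp
    then show ?thesis by blast
  qed
qed simp

text \<open>Column strictness leaves 1 over 2 as the only possible column through both rows.\<close>

lemma two_rows_12:
  assumes "two_rows r s" "set r \<union> set s \<subseteq> {1, 2}"
  shows "\<exists>p q k. (r, s, v) = rows12 p q k v"
proof -
  have lt: "r ! i = 1 \<and> s ! i = 2" if "i < length s" for i
  proof -
    have "r ! i < s ! i" "i < length r" using assms(1) that by (auto simp: two_rows_def)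
    then have "r ! i \<in> {1, 2}" "s ! i \<in> {1, 2}" using assms(2) that nth_mem by blast+
    then show ?thesis using \<open>r ! i < s ! i\<close> by auto
  qed
  then have s: "s = replicate (length s) 2" by (auto intro: nth_equalityI)
  obtain m q where r: "r = replicate m 1 @ replicate q 2"
    using sorted_12[of r] assms by (auto simp: two_rows_def)
  have "length s \<le> m"
  proof (rule ccontr)
    assume "\<not> length s \<le> m"
    then have "m < length s" "m < length r" using assms(1) by (auto simp: two_rows_def)
    then show False using lt[of m] r by (auto simp: nth_append)
  qed
  then have "(r, s, v) = rows12 (m - length s) q (length s) v" using r s by (simp add: rows12_def)
  then show ?thesis by blast
qed

text \<open>This is the bracketing rule: a new 1 pairs up with a singleton 2 if there is one and
  stays single otherwise.\<close>

lemma bump2_1: "bump2 (rows12 p q k v) 1 = (if q = 0 then rows12 (Suc p) 0 k v else rows12 p (q - 1) (Suc k) v)"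
proof (cases q)
  case 0
  have "row_insert 1 (replicate (p + k) 1) = (replicate (p + k) 1 @ [1], None)"
    by (rule row_insert_all_le) auto
  then show ?thesis using 0 by (simp add: rows12_def replicate_append_same)
next
  case (Suc q')
  have 1: "row_insert 1 (replicate (p + k) 1 @ replicate q 2) = (replicate (p + k) 1 @ 1 # replicate q' 2, Some 2)"
    using row_insert_append_le[of "replicate (p + k) 1" 1 "replicate q 2"] Suc by auto
  have 2: "row_insert 2 (replicate k 2) = (replicate k 2 @ [2], None)"
    by (rule row_insert_all_le) auto
  show ?thesis using bump2_Some[OF 1 2, of v] Suc
    by (simp add: rows12_def replicate_append_same replicate_app_Cons_same)
qed

lemma bump2_2: "bump2 (rows12 p q k v) 2 = rows12 p (Suc q) k v"
proof -
  have "row_insert 2 (replicate (p + k) 1 @ replicate q 2) = ((replicate (p + k) 1 @ replicate q 2) @ [2], None)"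
    by (rule row_insert_all_le) auto
  then show ?thesis by (simp add: rows12_def replicate_append_same)
qed

text \<open>The witnesses \<open>c\<close> and \<open>d\<close> are the numbers of singleton columns \<open>1\<close> and \<open>2\<close> of \<open>u\<close>, as
  one sees for \<open>p = q = 0\<close>.\<close>

lemma foldl_bump2_12:
  assumes "set u \<subseteq> {1, 2}"
  shows "\<exists>c d. \<forall>p q k v. \<exists>k'. foldl bump2 (rows12 p q k v) u = rows12 (p + (c - q)) (q - c + d) k' v \<and>
    p + (c - q) + k' = p + k + count_list u 1 \<and> q - c + d + k' = q + k + count_list u 2"
  using assms
proof (induction u rule: rev_induct)
  case Nil
  show ?case by (rule exI[of _ 0], rule exI[of _ 0]) simp
next
  case (snoc x u)
  then obtain c d where cd: "\<And>p q k v. \<exists>k'. foldl bump2 (rows12 p q k v) u = rows12 (p + (c - q)) (q - c + d) k' v \<and>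
    p + (c - q) + k' = p + k + count_list u 1 \<and> q - c + d + k' = q + k + count_list u 2" by auto
  \<comment> \<open>An appended 1 cancels one of the \<open>d\<close> unmatched 2s of
    \<open>u\<close> or, if none is left, becomes unmatched; an appended 2 is always
    unmatched.\<close>
  define c' where "c' = (if x = 1 \<and> d = 0 then Suc c else c)"
  define d' where "d' = (if x = 1 then d - 1 else Suc d)"
  show ?case
  proof (rule exI[of _ c'], rule exI[of _ d'], intro allI)
    fix p q k v
    obtain k' where k': "foldl bump2 (rows12 p q k v) u = rows12 (p + (c - q)) (q - c + d) k' v"
      "p + (c - q) + k' = p + k + count_list u 1" "q - c + d + k' = q + k + count_list u 2" using cd by blast
    have "x = 1 \<or> x = 2" "q - c + d = 0 \<or> 0 < q - c + d" using snoc.prems by auto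
    then consider (one0) "x = 1" "q - c + d = 0" | (one) "x = 1" "q - c + d > 0" | (two) "x = 2"
      by metis
    then show "\<exists>k'. foldl bump2 (rows12 p q k v) (u @ [x]) = rows12 (p + (c' - q)) (q - c' + d') k' v \<and>
      p + (c' - q) + k' = p + k + count_list (u @ [x]) 1 \<and> q - c' + d' + k' = q + k + count_list (u @ [x]) 2"
    proof cases
      case one0
      then have "foldl bump2 (rows12 p q k v) (u @ [x]) = rows12 (Suc (p + (c - q))) 0 k' v"
        using k' bump2_1[of "p + (c - q)" "q - c + d" k' v] by simp
      moreover have "p + (c' - q) = Suc (p + (c - q))" "q - c' + d' = 0" using one0 by (auto simp: c'_def d'_def)
      ultimately show ?thesis using k' one0 by auto
    next
      case one
      then have ne: "q - c + d \<noteq> 0" by linarith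
      have "foldl bump2 (rows12 p q k v) (u @ [x]) = rows12 (p + (c - q)) (q - c + d - 1) (Suc k') v"
        using k'(1) bump2_1[of "p + (c - q)" "q - c + d" k' v, unfolded if_not_P[OF ne]] one by simp
      moreover have "p + (c' - q) = p + (c - q)" "q - c' + d' = q - c + d - 1" using one by (auto simp: c'_def d'_def)
      ultimately show ?thesis using k' one by (intro exI[of _ "Suc k'"]) auto
    next
      case two
      then have "foldl bump2 (rows12 p q k v) (u @ [x]) = rows12 (p + (c - q)) (Suc (q - c + d)) k' v"
        using k' bump2_2[of "p + (c - q)" "q - c + d" k' v] by simp
      moreover have "p + (c' - q) = p + (c - q)" "q - c' + d' = Suc (q - c + d)" using two by (auto simp: c'_def d'_def)
      ultimately show ?thesis using k' two by auto
    qed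
  qed
qed

text \<open>Mirror image of \<open>bump2_1\<close> and \<open>bump2_2\<close>: with only two letters
  the slide is forced, and a 2 in front pairs up with a singleton 1 if there is one.\<close>

lemma top2_Cons_12:
  assumes w: "\<forall>y\<in>set w. 1 \<le> y" and top: "top2 w = rows12 p q k v"
  shows "top2 (1 # w) = rows12 (Suc p) q k v"
    and "top2 (2 # w) = (if p = 0 then rows12 0 (Suc q) k v else rows12 (p - 1) q (Suc k) v)"
proof -
  let ?r = "replicate (p + k) (1::nat) @ replicate q 2" and ?s = "replicate k (2::nat)"
  have top': "top2 w = (?r, ?s, v)" using top by (simp add: rows12_def)
  have 1: "\<exists>r s. top2 (1 # w) = (r, s, v) \<and> slide 1 ?r ?s r s"
    using top2_Cons[OF _ top', of 1] by simp
  have 2: "\<exists>r s. top2 (2 # w) = (r, s, v) \<and> slide 2 ?r ?s r s"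
    using top2_Cons[OF _ top', of 2] w by force
  show "top2 (1 # w) = rows12 (Suc p) q k v"
  proof -
    obtain r s where rs: "top2 (1 # w) = (r, s, v)" "slide 1 ?r ?s r s" using 1 by blast
    have pos: "\<forall>a\<in>set r. 1 \<le> a" using top2_set[OF rs(1)] w by auto
    from rs(2) show ?thesis
      unfolding slide_def
    proof (elim disjE conjE exE)
      \<comment> \<open>A 1 in the second row would need a 0 above it; the same argument excludes a
        nonempty \<open>C\<close> below.\<close>
      assume "r = ?r" "s = 1 # ?s"
      then have "r \<noteq> []" "r ! 0 < 1" using top2_two_rows[OF rs(1)] by (auto simp: two_rows_def)
      then show ?thesis using pos nth_mem[of 0 r] by fastforce
    next
      fix A B C c D
      assume AB: "?r = A @ B" "1 # ?s = C @ c # D" "r = A @ c # B" "s = C @ D" "length A = length C" "two_rows A C"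
      have "C = []"
      proof (cases C)
        case (Cons b C')
        then have "A \<noteq> []" "A ! 0 < 1" using AB by (auto simp: two_rows_def)
        then show ?thesis using pos AB(3) nth_mem[of 0 A] by fastforce
      qed
      then show ?thesis using AB rs(1) by (simp add: rows12_def)
    qed
  qed
  show "top2 (2 # w) = (if p = 0 then rows12 0 (Suc q) k v else rows12 (p - 1) q (Suc k) v)"
  proof -
    obtain r s where rs: "top2 (2 # w) = (r, s, v)" "slide 2 ?r ?s r s" using 2 by blast
    from rs(2) show ?thesis
      unfolding slide_def
    proof (elim disjE conjE exE)
      assume eq: "r = ?r" "s = 2 # ?s"
      then have "length s \<le> length r" "\<forall>i<length s. r ! i < s ! i"
        using top2_two_rows[OF rs(1)] by (auto simp: two_rows_def)
      then have k: "k < p + k + q" and lt: "?r ! k < (2 # ?s) ! k" using eq by auto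
      \<comment> \<open>The second row now reaches index \<open>k\<close>; for \<open>p = 0\<close>
        the entry above would be a 2.\<close>
      have "p \<noteq> 0"
      proof
        assume "p = 0"
        then have "?r ! k = 2" "(2 # ?s) ! k = 2" using k by (auto simp: nth_append nth_Cons')
        then show False using lt by simp
      qed
      then show ?thesis using eq rs(1) by (simp add: rows12_def)
    next
      fix A B C c D
      assume AB: "?r = A @ B" "2 # ?s = C @ c # D" "r = A @ c # B" "s = C @ D" "length A = length C"
        "two_rows A C" "two_rows B D" "sorted (A @ c # B)"
      have CcD: "replicate (Suc k) 2 = C @ c # D" using AB(2) by simp
      then have set2: "set (C @ c # D) = {2}" by (metis set_replicate_Suc)
      then have c: "c = 2" by auto
      \<comment> \<open>No 2 fits below the entries after \<open>c = 2\<close>, so \<open>D\<close>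
        is empty, while the entries above the 2s of \<open>C\<close> are less than 2. Thus
        \<open>?r\<close> splits where its 2s begin, and comparing the lengths of \<open>A\<close>
        and \<open>C\<close> gives \<open>p = 0\<close>.\<close>
      have B: "\<forall>a\<in>set B. 2 \<le> a" using AB(8) c by (simp add: sorted_append)
      have "D = []"
      proof (cases D)
        case (Cons d D')
        then have "B \<noteq> []" "B ! 0 < D ! 0" using AB(7) by (auto simp: two_rows_def)
        moreover have "D ! 0 = 2" using set2 Cons by auto
        ultimately show ?thesis using B nth_mem[of 0 B] by fastforce
      qed
      have lenC: "length C = k" using arg_cong[OF CcD, of length] \<open>D = []\<close> by simp
      have C: "C = replicate k 2" using lenC set2 by (intro replicate_eqI) auto
      have A: "\<forall>a\<in>set A. a < 2"
      proof
        fix a assume "a \<in> set A"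
        then obtain i where "i < length A" "a = A ! i" by (auto simp: in_set_conv_nth)
        then show "a < 2" using AB(5,6) C by (auto simp: two_rows_def)
      qed
      have "filter (\<lambda>a. a < 2) ?r = A"
        using A B AB(1) by (auto simp: filter_empty_conv filter_id_conv not_less)
      then have A_eq: "A = replicate (p + k) 1" by simp
      then have "B = replicate q 2" using AB(1) by simp
      moreover have "p = 0" using A_eq lenC AB(5) by simp
      ultimately show ?thesis using A_eq AB(3,4) rs(1) C c \<open>D = []\<close> by (simp add: rows12_def)
    qed
  qed
qed

text \<open>Here the unmatched 2s of \<open>u\<close> consume singleton 1s of \<open>w\<close>.
  Again \<open>c\<close> and \<open>d\<close> are the singleton counts of \<open>u\<close>, and
  counting the 1s fixes \<open>k'\<close>.\<close>

lemma top2_prepend_12: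
  assumes "set u \<subseteq> {1, 2}"
  shows "\<exists>c d. \<forall>w p q k v. (\<forall>y\<in>set w. 1 \<le> y) \<longrightarrow> top2 w = rows12 p q k v \<longrightarrow>
    (\<exists>k'. top2 (u @ w) = rows12 (p - d + c) (q + (d - p)) k' v \<and> p - d + c + k' = p + k + count_list u 1)"
  using assms
proof (induction u)
  case Nil
  show ?case by (rule exI[of _ 0], rule exI[of _ 0]) auto
next
  case (Cons x u)
  then have "set u \<subseteq> {1, 2}" by simp
  from Cons.IH[OF this] obtain c d where cd: "\<And>w p q k v. \<forall>y\<in>set w. 1 \<le> y \<Longrightarrow> top2 w = rows12 p q k v \<Longrightarrow>
    \<exists>k'. top2 (u @ w) = rows12 (p - d + c) (q + (d - p)) k' v \<and> p - d + c + k' = p + k + count_list u 1" by blast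
  \<comment> \<open>A prepended 1 is always unmatched; a prepended 2 cancels one of the
    \<open>c\<close> unmatched 1s of \<open>u\<close> or, if \<open>c = 0\<close>, becomes
    unmatched.\<close>
  define c' where "c' = (if x = 1 then Suc c else c - 1)"
  define d' where "d' = (if x = 2 \<and> c = 0 then Suc d else d)"
  show ?case
  proof (rule exI[of _ c'], rule exI[of _ d'], intro allI impI)
    fix w p q k v
    assume w: "\<forall>y\<in>set w. 1 \<le> y" and top: "top2 w = rows12 p q k v"
    obtain k' where k': "top2 (u @ w) = rows12 (p - d + c) (q + (d - p)) k' v"
      "p - d + c + k' = p + k + count_list u 1" using cd[OF w top] by blast
    have uw: "\<forall>y\<in>set (u @ w). 1 \<le> y" using w Cons.prems by auto
    note step = top2_Cons_12[OF uw k'(1)]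
    have "x = 1 \<or> x = 2" "p - d + c = 0 \<or> 0 < p - d + c" using Cons.prems by auto
    then consider (one) "x = 1" | (two0) "x = 2" "p - d + c = 0" | (two) "x = 2" "p - d + c > 0"
      by metis
    then show "\<exists>k'. top2 ((x # u) @ w) = rows12 (p - d' + c') (q + (d' - p)) k' v \<and>
      p - d' + c' + k' = p + k + count_list (x # u) 1"
    proof cases
      case one
      then show ?thesis using step(1) k' by (auto simp: c'_def d'_def)
    next
      case two0
      then have "top2 ((x # u) @ w) = rows12 0 (Suc (q + (d - p))) k' v" using step(2) by simp
      moreover have "p - d' + c' = 0" "q + (d' - p) = Suc (q + (d - p))" using two0 by (auto simp: c'_def d'_def)
      ultimately show ?thesis using two0 k' by auto
    next
      case two
      then have ne: "p - d + c \<noteq> 0" by linarith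
      have "top2 ((x # u) @ w) = rows12 (p - d + c - 1) (q + (d - p)) (Suc k') v"
        using step(2)[unfolded if_not_P[OF ne]] two by simp
      moreover have "p - d' + c' = p - d + c - 1" "q + (d' - p) = q + (d - p)" using two by (auto simp: c'_def d'_def)
      ultimately show ?thesis using two k' by (intro exI[of _ "Suc k'"]) auto
    qed
  qed
qed

section \<open>Comparing the two products\<close>

lemma singleton_columns_12:
  assumes "top2 w = rows12 p q k v"
  shows "singleton_columns 1 w = p" "singleton_columns 2 w = q"
proof -
  have "drop k (replicate (p + k) (1::nat) @ replicate q 2) = replicate p 1 @ replicate q 2"
    by simp
  then show "singleton_columns 1 w = p" "singleton_columns 2 w = q"
    using singleton_columns_top2[of w "replicate (p + k) 1 @ replicate q 2" "replicate k 2" v] assms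
    by (simp_all add: rows12_def count_list_replicate)
qed

text \<open>Both products will carry the overflow \<open>v\<close> of \<open>w\<close>, so only
  their first two rows have to be compared.\<close>

lemma insertion_tableau_eq_iff:
  assumes "top2 w = (r, s, v)" "top2 w' = (r', s', v)"
  shows "insertion_tableau w = insertion_tableau w' \<longleftrightarrow> r = r' \<and> s = s'"
proof
  assume "insertion_tableau w = insertion_tableau w'"
  from stack_eqD[OF this assms] show "r = r' \<and> s = s'" by simp
next
  assume "r = r' \<and> s = s'"
  then show "insertion_tableau w = insertion_tableau w'"
    using insertion_tableau_stack[OF assms(1)] insertion_tableau_stack[OF assms(2)] by simp
qed

lemma commute_12_iff:
  assumes u: "set u \<subseteq> {1, 2}" "count_list u 1 = count_list u 2"
    and w: "\<forall>y\<in>set w. 1 \<le> y" and top: "top2 w = rows12 p q k v"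
  shows "insertion_tableau (u @ w) = insertion_tableau (w @ u) \<longleftrightarrow>
    min p q \<ge> singleton_columns 1 u \<or> p = q \<and> q < singleton_columns 1 u"
proof -
  obtain c d where R: "\<And>p q k v. \<exists>k'. foldl bump2 (rows12 p q k v) u = rows12 (p + (c - q)) (q - c + d) k' v \<and>
    p + (c - q) + k' = p + k + count_list u 1 \<and> q - c + d + k' = q + k + count_list u 2"
    using foldl_bump2_12[OF u(1)] by blast
  obtain c' d' where L: "\<And>w p q k v. \<forall>y\<in>set w. 1 \<le> y \<Longrightarrow> top2 w = rows12 p q k v \<Longrightarrow>
    \<exists>k'. top2 (u @ w) = rows12 (p - d' + c') (q + (d' - p)) k' v \<and> p - d' + c' + k' = p + k + count_list u 1"
    using top2_prepend_12[OF u(1)] by blast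
  \<comment> \<open>On the empty word both pairs of witnesses give the singleton counts of
    \<open>u\<close>, so they coincide.\<close>
  have nil: "top2 [] = rows12 0 0 0 []" by (simp add: rows12_def)
  obtain k0 where k0: "top2 u = rows12 c d k0 []" "c + k0 = count_list u 1" "d + k0 = count_list u 2"
    using R[of 0 0 0 "[]"] top2_append[of "[]" u] nil by auto
  obtain k1 where "top2 u = rows12 c' d' k1 []" using L[OF _ nil] by auto
  then have cd': "c' = c" "d' = d" using rows12_eqD[of c d k0 "[]" c' d' k1 "[]"] k0 by auto
  have "d = c" using k0 u(2) by simp
  have sc: "singleton_columns 1 u = c" using singleton_columns_12[OF k0(1)] by simp
  obtain kR where kR: "top2 (w @ u) = rows12 (p + (c - q)) (q - c + c) kR v" "p + (c - q) + kR = p + k + count_list u 1"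
    using R[of p q k v] top2_append[of w u] top \<open>d = c\<close> by auto
  obtain kL where kL: "top2 (u @ w) = rows12 (p - c + c) (q + (c - p)) kL v" "p - c + c + kL = p + k + count_list u 1"
    using L[OF w top] cd' \<open>d = c\<close> by auto
  have "insertion_tableau (u @ w) = insertion_tableau (w @ u) \<longleftrightarrow>
      rows12 (p - c + c) (q + (c - p)) kL v = rows12 (p + (c - q)) (q - c + c) kR v"
    using insertion_tableau_eq_iff[OF kL(1)[unfolded rows12_def] kR(1)[unfolded rows12_def]]
    by (simp add: rows12_def)
  also have "\<dots> \<longleftrightarrow> p - c + c = p + (c - q) \<and> q + (c - p) = q - c + c \<and> kL = kR"
    by (auto dest: rows12_eqD)
  \<comment> \<open>\<open>p - c + c\<close> is the maximum of \<open>p\<close> and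
    \<open>c\<close>. The number of 1s agrees on both sides, so \<open>kL = kR\<close> follows from
    the first equation.\<close>
  also have "\<dots> \<longleftrightarrow> c \<le> min p q \<or> p = q \<and> q < c"
    using kL(2) kR(2) by auto
  finally show ?thesis by (simp only: sc)
qed

lemma tableau_rows_le_2_iff:
  assumes "top2 w = (r, s, v)"
  shows "(\<forall>i\<in>{1..2}. tableau_row i w \<noteq> [] \<longrightarrow> Max (set (tableau_row i w)) \<le> 2) \<longleftrightarrow>
    (\<forall>a\<in>set r \<union> set s. a \<le> 2)"
proof -
  have "tableau_row 1 w = r \<and> tableau_row 2 w = s"
    using insertion_tableau_stack[OF assms] by (auto simp: tableau_row_def stack_def)
  moreover have "{1..2} = {1, 2::nat}" by auto
  ultimately show ?thesis by (auto simp: ball_Un)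
qed

theorem theorem2p9:
  fixes n :: nat and u w :: "nat list"
  assumes "u \<in> lists {1..2}" and "length u = n"
    and "count_list u 1 = count_list u 2" and "count_list u 2 \<ge> 1"
    and "w \<in> words"
  shows "w \<in> plactic_centralizer u \<longleftrightarrow>
      (min (singleton_columns 1 w) (singleton_columns 2 w) \<ge> singleton_columns 1 u \<or> (singleton_columns 1 w = singleton_columns 2 w \<and> singleton_columns 2 w < singleton_columns 1 u)) \<and>
      (\<forall>i\<in>{1..2}. tableau_row i w \<noteq> [] \<longrightarrow> Max (set (tableau_row i w)) \<le> 2)"
proof -
  have "{1..2} = {1, 2::nat}" by auto
  then have sub: "set u \<subseteq> {1, 2}" using assms(1) by (simp add: in_lists_conv_set subset_iff)
  moreover have "1 \<in> set u" "2 \<in> set u" using assms(3,4) count_notin by fastforce+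
  ultimately have u: "set u = {1, 2}" by auto
  have w: "\<forall>y\<in>set w. 1 \<le> y" using assms(5) by (auto simp: words_def)
  obtain r s v where top: "top2 w = (r, s, v)" by (cases "top2 w") auto
  have cent: "w \<in> plactic_centralizer u \<longleftrightarrow> insertion_tableau (u @ w) = insertion_tableau (w @ u)"
    using assms(5) by (simp add: plactic_centralizer_def)
  have ge1: "\<forall>a\<in>set r \<union> set s. 1 \<le> a" using top2_set[OF top] w by auto
  show ?thesis
  proof (cases "set r \<union> set s \<subseteq> {1, 2}")
    case True
    then obtain p q k where pqk: "(r, s, v) = rows12 p q k v"
      using two_rows_12[OF top2_two_rows[OF top]] by blast
    have "\<forall>a\<in>set r \<union> set s. a \<le> 2" using True by auto
    then show ?thesis
      using commute_12_iff[OF sub assms(3) w top[unfolded pqk]] singleton_columns_12[OF top[unfolded pqk]]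
      unfolding cent tableau_rows_le_2_iff[OF top] by simp
  next
    case False
    \<comment> \<open>An entry above 2 in the first two rows makes both sides of the equivalence
      fail.\<close>
    then obtain a where a: "a \<in> set r \<union> set s" "a \<notin> {1, 2}" by blast
    then have "1 \<le> a" using ge1 by blast
    then have "\<not> (\<forall>a\<in>set r \<union> set s. a \<le> 2)" using a by force
    moreover have "w \<notin> plactic_centralizer u"
      using commute_two_rows_small[OF _ u w top] False cent by blast
    ultimately show ?thesis unfolding tableau_rows_le_2_iff[OF top] by blast
  qed
qed

end
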